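(* Let $X,Y$ be reflexive real Banach spaces and let $F:\mathcal{D}(F)\subseteq X\to Y$, $\Omega:\mathcal{D}(\Omega)\subseteq X\to[0,\infty)$, $\mathcal{D}=\mathcal{D}(F)\cap\mathcal{D}(\Omega)$, $\psi:[0,\infty)\to[0,\infty)$, $y\in F(\mathcal{D}(F))$, $x^\dagger\in\mathcal{D}$ and $\xi=\Omega'(x^\dagger)\in X^*$ satisfy the standing assumptions (A1)-(A6) and (B1)-(B3) listed in the context. Let $F'(x^\dagger)$ be injective and let $\xi\notin\mathcal{R}(F'(x^\dagger)^* )$. Let $\alpha_{\max}>0$ and $\rho:=\alpha_{\max}(1+\Omega(x^\dagger))$. Assume that for some index function $\sigma$ and some constant $C>0$ $$\|F'(x^\dagger)(x-x^\dagger)\|_Y\le C\,\sigma(\|F(x)-F(x^\dagger)\|_Y)\qquad\text{for all }x\in\mathcal{M}_{\alpha_{\max}}(\rho),$$ and that the Bregman distance is locally $q$-coercive with some $2\le q<\infty$, i.e. there is a constant $c_q>0$ such that $$D_\xi(x,x^\dagger)\ge c_q\,\|x-x^\dagger\|_X^q\qquad\text{for all }x\in\mathcal{M}_{\alpha_{\max}}(\rho).$$ Let $\frac1q+\frac1{q^*}=1$, let $$d(R):=\inf\{\|\xi-F'(x^\dagger)^*w\|_{X^*}:\ w\in Y^*,\ \|w\|_{Y^*}\le R\}\quad(R\ge0),$$ and let $\Psi:(0,\infty)\to(0,\infty)$, $\Psi(R):=\frac{d(R)^{q^*}}{R}$. Then there exist multipliers $0\le\beta_1<1$ and $\beta_2>0$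 such that the variational inequality $$\langle \xi,x^\dagger-x\rangle_{X^*,X}\le \beta_1 D_\xi(x,x^\dagger)+\beta_2\,\varphi(\|F(x)-F(x^\dagger)\|_Y)\qquad\text{for all }x\in\mathcal{M}_{\alpha_{\max}}(\rho)$$ holds with the index function $\varphi$ given by $\varphi(0)=0$ and $\varphi(t)=\left[d\left(\Psi^{-1}(\sigma(t))\right)\right]^{q^*}$ for $t>0$.
   Context: Index function: a continuous, strictly increasing function $\eta:[0,\infty)\to[0,\infty)$ with $\eta(0)=0$; restrictions of such functions to a segment $[0,\overline a]$, $0<\overline a<\infty$, are also called index functions (if $\sigma$ is only defined on a segment, it is understood that the arguments at which it is evaluated lie in that segment, and $\varphi$ is defined on the same segment). Setting: the equation $F(x)=y$ is considered, with exact right-hand side $y\in F(\mathcal{D}(F))$. For $\alpha>0$ put $T^0_\alpha(x)=\psi(\|F(x)-y\|_Y)+\alpha\Omega(x)$ and, for $c\ge0$, $\mathcal{M}_\alpha(c):=\{x\in\mathcal{D}: T^0_\alpha(x)\le c\}$. Standing assumptions: (A1) $X,Y$ are real Banach spaces with duals $X^*,Y^*$ and dual pairings $\langle\cdot,\cdot\rangle_{X^*,X}$, $\langle\cdot,\cdot\rangle_{Y^*,Y}$; $\rightharpoonup$ denotes weak convergence. (A2) $F$ is weakly-weakly sequentially continuous and $\mathcal{D}(F)$ is weakly sequentially closed: if $x_k\in\mathcal{D}(F)$ and $x_k\rightharpoonup x$ in $X$, then $x\in\mathcal{D}(F)$ and $F(x_k)\rightharpoonup F(x)$ in $Y$. (A3)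 $\mathcal{D}(\Omega)$ is convex and $\Omega$ is convex and weakly sequentially lower semi-continuous. (A4) $\mathcal{D}=\mathcal{D}(F)\cap\mathcal{D}(\Omega)\neq\emptyset$. (A5) For every $\alpha>0$ and $c\ge0$, every sequence in $\mathcal{M}_\alpha(c)$ has a subsequence that converges weakly in $X$ to some element of $X$. (A6) $\psi:[0,\infty)\to[0,\infty)$ is an index function and there are constants $a>0$, $b>0$ with $\psi(u+v)\le a\psi(u)+b\psi(v)$ for all $u,v\in[0,\infty)$. (B1) $x^\dagger\in\mathcal{D}$ is an $\Omega$-minimizing solution of $F(x)=y$, i.e. $F(x^\dagger)=y$ and $\Omega(x^\dagger)=\min\{\Omega(x):F(x)=y,\ x\in\mathcal{D}\}<\infty$. (B2) $F$ is Gâteaux differentiable at $x^\dagger$ with Gâteaux derivative $F'(x^\dagger)\in\mathcal{L}(X,Y)$ (bounded linear operators); $F'(x^\dagger)^*\in\mathcal{L}(Y^*,X^* )$ is its Banach space adjoint and $\mathcal{R}(\cdot)$ denotes the range. (B3) $\Omega$ is Gâteaux differentiable at $x^\dagger$ with Gâteaux derivative $\xi=\Omega'(x^\dagger)\in X^*$, so that the subdifferential $\partial\Omega(x^\dagger)=\{\xi\}$ is a singleton. Bregman distance: $D_\xi(x,x^\dagger):=\Omega(x)-\Omega(x^\dagger)-\langle\xi,x-x^\dagger\rangle_{X^*,X}$ for $x\in\mathcal{D}(\Omega)$. *)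

theory Defs
  imports "HOL-Analysis.Analysis"
begin

section \<open>Banach space notions\<close>

definition weakly_converges :: "(nat \<Rightarrow> 'a::real_normed_vector) \<Rightarrow> 'a \<Rightarrow> bool" where
  "weakly_converges u x \<longleftrightarrow> (\<forall>f :: 'a \<Rightarrow>\<^sub>L real. (\<lambda>k. f (u k)) \<longlonglongrightarrow> f x)"

text \<open>Surjectivity of the canonical embedding into the bidual.\<close>

definition reflexive_space :: "'a::real_normed_vector itself \<Rightarrow> bool" where
  "reflexive_space _ \<longleftrightarrow>
     (\<forall>G :: ('a \<Rightarrow>\<^sub>L real) \<Rightarrow>\<^sub>L real. \<exists>x :: 'a. \<forall>f. blinfun_apply G f = blinfun_apply f x)"

definition banach_adjoint ::
  "('a::real_normed_vector \<Rightarrow>\<^sub>L 'b::real_normed_vector) \<Rightarrow> ('b \<Rightarrow>\<^sub>L real) \<Rightarrow>\<^sub>L ('a \<Rightarrow>\<^sub>L real)" where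
  "banach_adjoint A = Blinfun (\<lambda>w. w o\<^sub>L A)"

lemma banach_adjoint_apply: "banach_adjoint A w = w o\<^sub>L A"
proof -
  have "bounded_linear (\<lambda>w :: 'b \<Rightarrow>\<^sub>L real. w o\<^sub>L A)"
    by (rule bounded_bilinear.bounded_linear_left[OF bounded_bilinear_blinfun_compose])
  then show ?thesis
    by (simp add: banach_adjoint_def bounded_linear_Blinfun_apply)
qed

text \<open>
  A function given on a domain \<open>S\<close> is represented by a total function together with \<open>S\<close>; its
  values outside \<open>S\<close> never matter. In particular the difference quotients below must
  eventually be formed inside \<open>S\<close>, in every direction.
\<close>

definition has_gateaux_derivative_on ::
  "('a::real_normed_vector \<Rightarrow> 'b::real_normed_vector) \<Rightarrow> ('a \<Rightarrow>\<^sub>L 'b) \<Rightarrow> 'a set \<Rightarrow> 'a \<Rightarrow> bool" where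
  "has_gateaux_derivative_on f A S x \<longleftrightarrow>
     x \<in> S \<and>
     (\<forall>h. (\<forall>\<^sub>F t :: real in at 0. x + t *\<^sub>R h \<in> S) \<and>
          ((\<lambda>t :: real. (f (x + t *\<^sub>R h) - f x) /\<^sub>R t) \<longlongrightarrow> A h) (at 0))"

definition weakly_weakly_seq_continuous_on ::
  "'a::real_normed_vector set \<Rightarrow> ('a \<Rightarrow> 'b::real_normed_vector) \<Rightarrow> bool" where
  "weakly_weakly_seq_continuous_on S f \<longleftrightarrow>
     (\<forall>u x. (\<forall>k. u k \<in> S) \<and> x \<in> S \<and> weakly_converges u x \<longrightarrow>
        weakly_converges (\<lambda>k. f (u k)) (f x))"

definition weakly_seq_closed :: "'a::real_normed_vector set \<Rightarrow> bool" where
  "weakly_seq_closed S \<longleftrightarrow>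
     (\<forall>u x. (\<forall>k. u k \<in> S) \<and> weakly_converges u x \<longrightarrow> x \<in> S)"

definition weakly_seq_lsc_on ::
  "'a::real_normed_vector set \<Rightarrow> ('a \<Rightarrow> real) \<Rightarrow> bool" where
  "weakly_seq_lsc_on S f \<longleftrightarrow>
     (\<forall>u x. (\<forall>k. u k \<in> S) \<and> x \<in> S \<and> weakly_converges u x \<longrightarrow>
        ereal (f x) \<le> liminf (\<lambda>k. ereal (f (u k))))"

definition subdifferential_on ::
  "'a::real_normed_vector set \<Rightarrow> ('a \<Rightarrow> real) \<Rightarrow> 'a \<Rightarrow> ('a \<Rightarrow>\<^sub>L real) set" where
  "subdifferential_on S f x = {\<eta>. \<forall>z\<in>S. f x + blinfun_apply \<eta> (z - x) \<le> f z}"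

lemma subdifferential_on_gateaux:
  fixes f :: "'a::real_normed_vector \<Rightarrow> real" and \<xi> :: "'a \<Rightarrow>\<^sub>L real"
  assumes conv: "convex_on S f" and G: "has_gateaux_derivative_on f \<xi> S x"
  shows "subdifferential_on S f x = {\<xi>}"
proof -
  have xS: "x \<in> S" and ev: "\<And>h. \<forall>\<^sub>F t :: real in at 0. x + t *\<^sub>R h \<in> S"
    and lim: "\<And>h. ((\<lambda>t :: real. (f (x + t *\<^sub>R h) - f x) /\<^sub>R t) \<longlongrightarrow> \<xi> h) (at 0)"
    using G by (auto simp: has_gateaux_derivative_on_def)
  have lim': "((\<lambda>t :: real. (f (x + t *\<^sub>R h) - f x) /\<^sub>R t) \<longlongrightarrow> \<xi> h) (at_right 0)" for h
    using lim by (rule tendsto_mono[rotated]) (simp add: at_le)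
  have ev': "\<forall>\<^sub>F t :: real in at_right 0. x + t *\<^sub>R h \<in> S" for h
    using ev by (rule filter_leD[rotated]) (simp add: at_le)
  have "\<xi> \<in> subdifferential_on S f x"
  proof -
    have "\<xi> (z - x) \<le> f z - f x" if z: "z \<in> S" for z
    proof (rule tendsto_upperbound[OF lim'])
      have "\<forall>\<^sub>F t :: real in at_right 0. t \<in> {0<..<1}"
        by (rule eventually_at_right_real) simp
      then show "\<forall>\<^sub>F t :: real in at_right 0. (f (x + t *\<^sub>R (z - x)) - f x) /\<^sub>R t \<le> f z - f x"
      proof eventually_elim
        case (elim t)
        have "f ((1 - t) *\<^sub>R x + t *\<^sub>R z) \<le> (1 - t) * f x + t * f z"
          using elim by (intro convex_onD[OF conv]) (auto simp: xS z)
        moreover have "(1 - t) *\<^sub>R x + t *\<^sub>R z = x + t *\<^sub>R (z - x)"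
          by (simp add: algebra_simps)
        ultimately have "f (x + t *\<^sub>R (z - x)) - f x \<le> t * (f z - f x)"
          by (simp add: algebra_simps)
        then show ?case
          using elim by (simp add: field_simps)
      qed
    qed simp
    then show ?thesis
      by (force simp: subdifferential_on_def)
  qed
  moreover have "\<eta> = \<xi>" if \<eta>: "\<eta> \<in> subdifferential_on S f x" for \<eta>
  proof -
    have le: "\<eta> h \<le> \<xi> h" for h
    proof (rule tendsto_lowerbound[OF lim'])
      have "\<forall>\<^sub>F t :: real in at_right 0. t \<in> {0<..<1}"
        by (rule eventually_at_right_real) simp
      with ev'[of h] show "\<forall>\<^sub>F t :: real in at_right 0. \<eta> h \<le> (f (x + t *\<^sub>R h) - f x) /\<^sub>R t"
      proof eventually_elim
        case (elim t)
        have "f x + \<eta> (x + t *\<^sub>R h - x) \<le> f (x + t *\<^sub>R h)"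
          using \<eta> elim(1) unfolding subdifferential_on_def by blast
        then have "t * \<eta> h \<le> f (x + t *\<^sub>R h) - f x"
          by (simp add: blinfun.scaleR_right)
        then show ?case
          using elim by (simp add: field_simps)
      qed
    qed simp
    have "\<eta> h = \<xi> h" for h
      using le[of h] le[of "- h"] by (simp add: blinfun.minus_right)
    then show ?thesis
      by (rule blinfun_eqI)
  qed
  ultimately show ?thesis
    by blast
qed


section \<open>Index functions\<close>

definition index_function :: "(real \<Rightarrow> real) \<Rightarrow> bool" where
  "index_function \<eta> \<longleftrightarrow>
     \<eta> ` {0..} \<subseteq> {0..} \<and> continuous_on {0..} \<eta> \<and> strict_mono_on {0..} \<eta> \<and> \<eta> 0 = 0"

definition index_domain :: "real set \<Rightarrow> bool" where
  "index_domain J \<longleftrightarrow> J = {0..} \<or> (\<exists>a>0. J = {0..a})"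

definition index_function_on :: "real set \<Rightarrow> (real \<Rightarrow> real) \<Rightarrow> bool" where
  "index_function_on J \<eta> \<longleftrightarrow>
     index_domain J \<and> (\<exists>\<theta>. index_function \<theta> \<and> (\<forall>t\<in>J. \<eta> t = \<theta> t))"


section \<open>Tikhonov regularization\<close>

definition tikhonov_functional ::
  "(real \<Rightarrow> real) \<Rightarrow> ('a \<Rightarrow> 'b::real_normed_vector) \<Rightarrow> 'b \<Rightarrow> ('a \<Rightarrow> real) \<Rightarrow> real \<Rightarrow> 'a \<Rightarrow> real" where
  "tikhonov_functional \<psi> F y \<Omega> \<alpha> x = \<psi> (norm (F x - y)) + \<alpha> * \<Omega> x"

definition level_set ::
  "'a set \<Rightarrow> (real \<Rightarrow> real) \<Rightarrow> ('a \<Rightarrow> 'b::real_normed_vector) \<Rightarrow> 'b \<Rightarrow> ('a \<Rightarrow> real) \<Rightarrow> real \<Rightarrow> real \<Rightarrow> 'a set"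
  where
  "level_set D \<psi> F y \<Omega> \<alpha> c = {x\<in>D. tikhonov_functional \<psi> F y \<Omega> \<alpha> x \<le> c}"

definition minimizing_solution ::
  "'a set \<Rightarrow> ('a \<Rightarrow> 'b) \<Rightarrow> 'b \<Rightarrow> ('a \<Rightarrow> real) \<Rightarrow> 'a \<Rightarrow> bool" where
  "minimizing_solution D F y \<Omega> x \<longleftrightarrow>
     x \<in> D \<and> F x = y \<and> (\<forall>z\<in>D. F z = y \<longrightarrow> \<Omega> x \<le> \<Omega> z)"

definition bregman_distance ::
  "('a::real_normed_vector \<Rightarrow> real) \<Rightarrow> ('a \<Rightarrow>\<^sub>L real) \<Rightarrow> 'a \<Rightarrow> 'a \<Rightarrow> real" where
  "bregman_distance \<Omega> \<xi> x x0 = \<Omega> x - \<Omega> x0 - \<xi> (x - x0)"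

definition distance_function ::
  "('a::real_normed_vector \<Rightarrow>\<^sub>L real) \<Rightarrow> ('a \<Rightarrow>\<^sub>L 'b::real_normed_vector) \<Rightarrow> real \<Rightarrow> real" where
  "distance_function \<xi> A R = Inf {norm (\<xi> - banach_adjoint A w) | w. norm w \<le> R}"

definition Psi ::
  "('a::real_normed_vector \<Rightarrow>\<^sub>L real) \<Rightarrow> ('a \<Rightarrow>\<^sub>L 'b::real_normed_vector) \<Rightarrow> real \<Rightarrow> real \<Rightarrow> real" where
  "Psi \<xi> A p R = distance_function \<xi> A R powr p / R"

definition rate_function ::
  "('a::real_normed_vector \<Rightarrow>\<^sub>L real) \<Rightarrow> ('a \<Rightarrow>\<^sub>L 'b::real_normed_vector) \<Rightarrow> real \<Rightarrow> (real \<Rightarrow> real) \<Rightarrow>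
   real \<Rightarrow> real" where
  "rate_function \<xi> A p \<sigma> t =
     (if t = 0 then 0
      else distance_function \<xi> A (inv_into {0<..} (Psi \<xi> A p) (\<sigma> t)) powr p)"

end

theory Submission
  imports Defs
begin

text \<open>
  Write \<open>A\<close> for the derivative \<open>F'(x0)\<close> and \<open>d\<close> for the distance function. The variational
  inequality itself is a duality argument. For \<open>x \<in> M\<close> and every \<open>w\<close> with \<open>\<parallel>w\<parallel> \<le> R\<close>,
  \<open>\<xi> (x0 - x) = (\<xi> - A\<^sup>* w) (x0 - x) + w (A (x0 - x)) \<le> \<parallel>\<xi> - A\<^sup>* w\<parallel> \<parallel>x - x0\<parallel> + R \<parallel>A (x - x0)\<parallel>\<close>,
  and the infimum over \<open>w\<close> turns the first coefficient into \<open>d R\<close>. With the nonlinearity condition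
  the second term is at most \<open>C R \<sigma> t\<close> for \<open>t = \<parallel>F x - F x0\<parallel>\<close>. Young's inequality and the
  \<open>q\<close>-coercivity split the first term into \<open>D / q\<close>, where \<open>D\<close> is the Bregman distance, and a
  multiple of \<open>d R powr p\<close>. The choice \<open>Psi R = \<sigma> t\<close> balances the two remaining terms, since it
  means \<open>R \<sigma> t = d R powr p\<close>. It requires \<open>t > 0\<close>; for \<open>t = 0\<close> the nonlinearity condition and the
  injectivity of \<open>A\<close> give \<open>x = x0\<close>.

  For this choice to be possible, and for the resulting rate to be an index function, \<open>d\<close> has to
  be positive, strictly decreasing and convergent to \<open>0\<close>; this is where functional analysis enters.
  Positivity: if \<open>d R = 0\<close>, then \<open>\<bar>\<xi> x\<bar> \<le> R \<parallel>A x\<parallel>\<close> for all \<open>x\<close>, and by Hahn-Banach \<open>\<xi>\<close> factors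
  through \<open>A\<close>, that is, \<open>\<xi>\<close> lies in the range of \<open>A\<^sup>*\<close> (lemma \<open>range_adjointI\<close>).
  Convergence: a bounded functional on the dual space that annihilates the range of \<open>A\<^sup>*\<close> is, by
  reflexivity, the evaluation at some \<open>x\<close> with \<open>A x = 0\<close>, so it vanishes when \<open>A\<close> is injective;
  hence the range is dense (lemma \<open>adjoint_dense_range\<close>).
  Strict decrease: \<open>d\<close> is convex, and a convex function that decreases to \<open>0\<close> without reaching it
  is strictly decreasing (lemma \<open>distance_function_strict_antimono\<close>).

  The Hahn-Banach theorem is derived here in the form: every sublinear functional dominates a
  linear one. All extension problems are reduced to it by forming a suitable infimum of sublinear
  functionals.
\<close>

section \<open>Sublinear functionals and the Hahn-Banach theorem\<close>

text \<open>
  Homogeneity is demanded only as an inequality for positive factors; rescaling by the inverse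
  factor gives the reverse inequality.
\<close>

definition sublinear :: "('a::real_vector \<Rightarrow> real) \<Rightarrow> bool" where
  "sublinear f \<longleftrightarrow> (\<forall>x y. f (x + y) \<le> f x + f y) \<and> (\<forall>c>0. \<forall>x. f (c *\<^sub>R x) \<le> c * f x)"

lemma sublinear_add: "sublinear f \<Longrightarrow> f (x + y) \<le> f x + f y"
  by (simp add: sublinear_def)

lemma sublinear_scaleR:
  assumes "sublinear f" "c > 0"
  shows "f (c *\<^sub>R x) = c * f x"
proof (rule antisym)
  show "f (c *\<^sub>R x) \<le> c * f x"
    using assms by (simp add: sublinear_def)
  have "f (inverse c *\<^sub>R (c *\<^sub>R x)) \<le> inverse c * f (c *\<^sub>R x)"
    using assms unfolding sublinear_def by (meson positive_imp_inverse_positive)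
  then show "c * f x \<le> f (c *\<^sub>R x)"
    using assms(2) by (simp add: field_simps)
qed

lemma sublinear_zero: "sublinear f \<Longrightarrow> f 0 = 0"
  using sublinear_scaleR[of f 2 0] by simp

lemma sublinear_minus: "sublinear f \<Longrightarrow> - f (- x) \<le> f x"
  using sublinear_add[of f x "- x"] by (simp add: sublinear_zero)

text \<open>
  Minimizing a jointly sublinear expression over a convex cone in one of its arguments leaves a
  sublinear functional of the other; this produces every auxiliary functional below.
\<close>

lemma sublinear_INF:
  fixes h :: "'c::real_vector \<Rightarrow> 'a::real_vector \<Rightarrow> real"
  assumes K: "K \<noteq> {}" "\<And>x y. x \<in> K \<Longrightarrow> y \<in> K \<Longrightarrow> x + y \<in> K"
      "\<And>c x. c > 0 \<Longrightarrow> x \<in> K \<Longrightarrow> c *\<^sub>R x \<in> K"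
    and add: "\<And>x y u v. x \<in> K \<Longrightarrow> y \<in> K \<Longrightarrow> h (x + y) (u + v) \<le> h x u + h y v"
    and scale: "\<And>c x u. c > 0 \<Longrightarrow> x \<in> K \<Longrightarrow> h (c *\<^sub>R x) (c *\<^sub>R u) \<le> c * h x u"
    and bound: "\<And>x u. x \<in> K \<Longrightarrow> B u \<le> h x u"
  shows "sublinear (\<lambda>u. INF x\<in>K. h x u)"
    and "\<And>x u. x \<in> K \<Longrightarrow> (INF x\<in>K. h x u) \<le> h x u"
proof -
  have bdd: "bdd_below ((\<lambda>x. h x u) ` K)" for u
    using bound by (auto intro!: bdd_belowI[of _ "B u"])
  show lower: "(INF x\<in>K. h x u) \<le> h x u" if "x \<in> K" for x u
    by (rule cINF_lower[OF bdd that])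
  show "sublinear (\<lambda>u. INF x\<in>K. h x u)"
    unfolding sublinear_def
  proof (intro conjI allI impI)
    fix u v
    have "(INF x\<in>K. h x (u + v)) - h y v \<le> (INF x\<in>K. h x u)" if y: "y \<in> K" for y
    proof (rule cINF_greatest[OF K(1)])
      fix x assume x: "x \<in> K"
      show "(INF x\<in>K. h x (u + v)) - h y v \<le> h x u"
        using lower[OF K(2)[OF x y], of "u + v"] add[OF x y, of u v] by linarith
    qed
    then have "(INF x\<in>K. h x (u + v)) - (INF x\<in>K. h x u) \<le> h y v" if "y \<in> K" for y
      using that by (simp add: algebra_simps)
    then have "(INF x\<in>K. h x (u + v)) - (INF x\<in>K. h x u) \<le> (INF x\<in>K. h x v)"
      by (rule cINF_greatest[OF K(1)])
    then show "(INF x\<in>K. h x (u + v)) \<le> (INF x\<in>K. h x u) + (INF x\<in>K. h x v)"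
      by linarith
  next
    fix c :: real and u assume c: "c > 0"
    have "(INF x\<in>K. h x (c *\<^sub>R u)) / c \<le> (INF x\<in>K. h x u)"
    proof (rule cINF_greatest[OF K(1)])
      fix x assume x: "x \<in> K"
      have "(INF x\<in>K. h x (c *\<^sub>R u)) \<le> c * h x u"
        using lower[OF K(3)[OF c x], of "c *\<^sub>R u"] scale[OF c x, of u] by linarith
      then show "(INF x\<in>K. h x (c *\<^sub>R u)) / c \<le> h x u"
        using c by (simp add: field_simps)
    qed
    then show "(INF x\<in>K. h x (c *\<^sub>R u)) \<le> c * (INF x\<in>K. h x u)"
      using c by (simp add: field_simps)
  qed
qed

text \<open>
  Lowering a sublinear functional as far as possible along the ray spanned by \<open>a\<close> forces its value
  at \<open>- a\<close> down to \<open>- f a\<close>, the smallest value that sublinearity permits. Applied to a minimal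
  functional this yields additivity; applied to an arbitrary one it prescribes the value at \<open>a\<close> of
  any linear minorant.
\<close>

lemma sublinear_lower_along_ray:
  fixes f :: "'a::real_vector \<Rightarrow> real"
  assumes f: "sublinear f"
  obtains g where "sublinear g" "\<And>x. g x \<le> f x" "\<And>x. g x \<le> f (x + a) - f a"
proof -
  define h where "h t x = f (x + t *\<^sub>R a) - t * f a" for t :: real and x
  have scale0: "f (c *\<^sub>R x) = c * f x" if "c \<ge> 0" for c x
    using that sublinear_scaleR[OF f] sublinear_zero[OF f] by (cases "c = 0") auto
  have h_bound: "- f (- x) \<le> h t x" if "t \<in> {0..}" for t x
    using sublinear_add[OF f, of "x + t *\<^sub>R a" "- x"] that by (simp add: h_def scale0)
  have h_add: "h (s + t) (x + y) \<le> h s x + h t y" for s t x y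
    using sublinear_add[OF f, of "x + s *\<^sub>R a" "y + t *\<^sub>R a"]
    by (simp add: h_def algebra_simps)
  have h_scale: "h (c *\<^sub>R t) (c *\<^sub>R x) \<le> c * h t x" if "c > 0" for c t x
    using sublinear_scaleR[OF f that, of "x + t *\<^sub>R a"] by (simp add: h_def algebra_simps)
  have sub: "sublinear (\<lambda>x. INF t\<in>{0..}. h t x)"
    and lower: "\<And>t x. t \<in> {0..} \<Longrightarrow> (INF t\<in>{0..}. h t x) \<le> h t x"
    by (rule sublinear_INF[where B="\<lambda>x. - f (- x)"]; use h_add h_scale h_bound in auto)+
  show thesis
    by (rule that[OF sub]) (use lower[of 0] lower[of 1] in \<open>simp_all add: h_def\<close>)
qed

lemma minimal_sublinear_imp_linear:
  fixes f :: "'a::real_vector \<Rightarrow> real"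
  assumes f: "sublinear f" and min: "\<And>g. sublinear g \<Longrightarrow> g \<le> f \<Longrightarrow> g = f"
  shows "linear f"
proof -
  have add: "f (x + y) = f x + f y" for x y
  proof -
    obtain g where g: "sublinear g" "\<And>x. g x \<le> f x" "\<And>x. g x \<le> f (x + y) - f y"
      using sublinear_lower_along_ray[OF f] by metis
    then have "g = f"
      by (intro min) (auto simp: le_fun_def)
    then show ?thesis
      using g(3)[of x] sublinear_add[OF f, of x y] by simp
  qed
  have minus: "f (- x) = - f x" for x
    using add[of x "- x"] sublinear_zero[OF f] by simp
  have "f (c *\<^sub>R x) = c * f x" for c x
  proof -
    consider "c > 0" | "c = 0" | "- c > 0" by linarith
    then show ?thesis
    proof cases
      case 3
      then have "f (- c *\<^sub>R x) = - c * f x"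
        by (rule sublinear_scaleR[OF f])
      then show ?thesis
        using minus[of "c *\<^sub>R x"] by simp
    qed (simp_all add: sublinear_scaleR[OF f] sublinear_zero[OF f])
  qed
  with add show ?thesis
    by (intro linearI) simp_all
qed

text \<open>
  Along a chain of sublinear functionals below \<open>f\<close> the pointwise infimum is again sublinear: two
  members are comparable, so the smaller one can be used for both summands.
\<close>

lemma sublinear_INF_chain:
  fixes f :: "'a::real_vector \<Rightarrow> real"
  assumes "C \<noteq> {}" and sub: "\<And>g. g \<in> C \<Longrightarrow> sublinear g" and le: "\<And>g. g \<in> C \<Longrightarrow> g \<le> f"
    and chain: "\<And>g h. g \<in> C \<Longrightarrow> h \<in> C \<Longrightarrow> g \<le> h \<or> h \<le> g"
  shows "sublinear (\<lambda>x. INF g\<in>C. g x)" and "\<And>g x. g \<in> C \<Longrightarrow> (INF g\<in>C. g x) \<le> g x"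
proof -
  have "- f (- x) \<le> g x" if "g \<in> C" for g x
    using sublinear_minus[OF sub[OF that], of x] le[OF that] by (force simp: le_fun_def dest: spec[of _ "- x"])
  then have bdd: "bdd_below ((\<lambda>g. g x) ` C)" for x
    by (auto intro!: bdd_belowI[of _ "- f (- x)"])
  show lower: "(INF g\<in>C. g x) \<le> g x" if "g \<in> C" for g x
    by (rule cINF_lower[OF bdd that])
  show "sublinear (\<lambda>x. INF g\<in>C. g x)"
    unfolding sublinear_def
  proof (intro conjI allI impI)
    fix x y
    have *: "(INF g\<in>C. g (x + y)) \<le> g x + h y" if "g \<in> C" "h \<in> C" for g h
    proof -
      have "\<exists>k\<in>C. k \<le> g \<and> k \<le> h"
        using chain[OF that] that by auto
      then obtain k where k: "k \<in> C" "k \<le> g" "k \<le> h"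
        by blast
      have "(INF g\<in>C. g (x + y)) \<le> k x + k y"
        using lower[OF k(1), of "x + y"] sublinear_add[OF sub[OF k(1)], of x y] by linarith
      also have "\<dots> \<le> g x + h y"
        using k by (intro add_mono) (auto simp: le_fun_def)
      finally show ?thesis .
    qed
    have "(INF g\<in>C. g (x + y)) - h y \<le> (INF g\<in>C. g x)" if "h \<in> C" for h
      by (rule cINF_greatest[OF assms(1)]) (use * that in \<open>auto simp: algebra_simps\<close>)
    then have "(INF g\<in>C. g (x + y)) - (INF g\<in>C. g x) \<le> (INF g\<in>C. g y)"
      by (intro cINF_greatest[OF assms(1)]) (simp add: algebra_simps)
    then show "(INF g\<in>C. g (x + y)) \<le> (INF g\<in>C. g x) + (INF g\<in>C. g y)"
      by linarith
  next
    fix c :: real and x assume c: "c > 0"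
    have "(INF g\<in>C. g (c *\<^sub>R x)) / c \<le> (INF g\<in>C. g x)"
    proof (rule cINF_greatest[OF assms(1)])
      fix g assume g: "g \<in> C"
      show "(INF g\<in>C. g (c *\<^sub>R x)) / c \<le> g x"
        using lower[OF g, of "c *\<^sub>R x"] sublinear_scaleR[OF sub[OF g] c, of x] c
        by (simp add: field_simps)
    qed
    then show "(INF g\<in>C. g (c *\<^sub>R x)) \<le> c * (INF g\<in>C. g x)"
      using c by (simp add: field_simps)
  qed
qed

text \<open>
  Hahn-Banach without partially defined functionals: Zorn's lemma gives a minimal sublinear
  functional below \<open>f\<close>, and minimality forces linearity.
\<close>

theorem sublinear_dominates_linear:
  fixes f :: "'a::real_vector \<Rightarrow> real"
  assumes f: "sublinear f"
  obtains g where "linear g" "\<And>x. g x \<le> f x"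
proof -
  let ?S = "{g. sublinear g \<and> g \<le> f}"
  (* Zorn's lemma speaks of maximal elements, hence the reversed order. *)
  let ?P = "\<lambda>g h :: 'a \<Rightarrow> real. h \<le> g"
  have "\<exists>m\<in>?S. \<forall>g\<in>?S. ?P m g \<longrightarrow> g = m"
  proof (rule predicate_Zorn)
    show "partial_order_on ?S (relation_of ?P ?S)"
      by (rule partial_order_on_relation_ofI) auto
    fix C assume "C \<in> Chains (relation_of ?P ?S)"
    then have C: "C \<subseteq> ?S" "\<And>g h. g \<in> C \<Longrightarrow> h \<in> C \<Longrightarrow> g \<le> h \<or> h \<le> g"
      by (auto simp: Chains_def relation_of_def)
    show "\<exists>u\<in>?S. \<forall>g\<in>C. ?P g u"
    proof (cases "C = {}")
      case True
      then show ?thesis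
        using f by auto
    next
      case False
      then obtain g0 where g0: "g0 \<in> C"
        by auto
      have sub: "sublinear (\<lambda>x. INF g\<in>C. g x)"
        and lower: "\<And>g x. g \<in> C \<Longrightarrow> (INF g\<in>C. g x) \<le> g x"
        by (rule sublinear_INF_chain[OF False, where f=f]; use C in auto)+
      have "(\<lambda>x. INF g\<in>C. g x) \<le> g0"
        using lower[OF g0] by (auto simp: le_fun_def)
      also have "g0 \<le> f"
        using C(1) g0 by auto
      finally show ?thesis
        using sub lower by (intro bexI[of _ "\<lambda>x. INF g\<in>C. g x"]) (auto simp: le_fun_def)
    qed
  qed
  then obtain m where m: "sublinear m" "m \<le> f"
      "\<And>g. sublinear g \<Longrightarrow> g \<le> f \<Longrightarrow> g \<le> m \<Longrightarrow> g = m"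
    by auto
  then have "linear m"
    by (intro minimal_sublinear_imp_linear) (auto intro: order_trans)
  with m(2) show thesis
    by (intro that) (auto simp: le_fun_def)
qed

corollary sublinear_supporting_linear:
  fixes f :: "'a::real_vector \<Rightarrow> real"
  assumes f: "sublinear f"
  obtains g where "linear g" "\<And>x. g x \<le> f x" "g a = f a"
proof -
  obtain f' where f': "sublinear f'" "\<And>x. f' x \<le> f x" "\<And>x. f' x \<le> f (x + a) - f a"
    using sublinear_lower_along_ray[OF f] by metis
  obtain g where g: "linear g" "\<And>x. g x \<le> f' x"
    using sublinear_dominates_linear[OF f'(1)] by metis
  have "g (- a) \<le> - f a"
    using g(2)[of "- a"] f'(3)[of "- a"] sublinear_zero[OF f] by simp
  then have "f a \<le> g a"
    by (simp add: linear_neg[OF g(1)])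
  moreover have le: "g x \<le> f x" for x
    using g(2) f'(2) order_trans by blast
  ultimately show thesis
    using that[OF g(1) le] by (simp add: antisym)
qed

lemma linear_le_norm_imp_blinfun:
  fixes g :: "'a::real_normed_vector \<Rightarrow> real"
  assumes "linear g" and le: "\<And>x. g x \<le> R * norm x" and "0 \<le> R"
  obtains w :: "'a \<Rightarrow>\<^sub>L real" where "\<And>x. blinfun_apply w x = g x" "norm w \<le> R"
proof -
  have bound: "\<bar>g x\<bar> \<le> R * norm x" for x
    using le[of x] le[of "- x"] linear_neg[OF assms(1), of x] by simp
  have "bounded_linear g"
    by (rule bounded_linear_intro[of _ R])
      (use assms bound in \<open>auto simp: linear_add linear_cmul mult.commute\<close>)
  then have w: "blinfun_apply (Blinfun g) x = g x" for x
    by (simp add: bounded_linear_Blinfun_apply)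
  have "norm (Blinfun g) \<le> R"
    by (rule norm_blinfun_bound) (use bound w \<open>0 \<le> R\<close> in auto)
  with w show thesis
    by (rule that)
qed

corollary norming_functional:
  fixes x :: "'a::real_normed_vector"
  obtains w :: "'a \<Rightarrow>\<^sub>L real" where "norm w \<le> 1" "blinfun_apply w x = norm x"
proof -
  have "sublinear (norm :: 'a \<Rightarrow> real)"
    by (simp add: sublinear_def norm_triangle_ineq)
  then obtain g :: "'a \<Rightarrow> real" where g: "linear g" "\<And>z. g z \<le> norm z" "g x = norm x"
    using sublinear_supporting_linear[of norm x] by metis
  have "g z \<le> 1 * norm z" for z
    using g(2) by simp
  then obtain w :: "'a \<Rightarrow>\<^sub>L real" where "\<And>z. blinfun_apply w z = g z" "norm w \<le> 1"
    using linear_le_norm_imp_blinfun[OF g(1) _ zero_le_one] by metis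
  with g(3) show thesis
    by (intro that) auto
qed

section \<open>The range of the adjoint\<close>

text \<open>
  The functional \<open>A x \<mapsto> \<xi> x\<close> has to be extended from the range of \<open>A\<close>. Any linear minorant \<open>g\<close> of
  \<open>z \<mapsto> inf\<^sub>x (\<xi> x + R \<parallel>z - A x\<parallel>)\<close> is such an extension: at \<open>z = A x\<close> it gives \<open>g \<circ> A \<le> \<xi>\<close>, hence
  equality by linearity, and \<open>x = 0\<close> gives the norm bound.
\<close>

lemma range_adjointI:
  fixes A :: "'a::real_normed_vector \<Rightarrow>\<^sub>L 'b::real_normed_vector"
  assumes le: "\<And>x. \<bar>blinfun_apply \<xi> x\<bar> \<le> R * norm (A x)" and R: "0 \<le> R"
  shows "\<xi> \<in> range (blinfun_apply (banach_adjoint A))"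
proof -
  define h where "h x z = \<xi> x + R * norm (z - A x)" for x z
  have h_bound: "- (R * norm z) \<le> h x z" for x z
  proof -
    have "norm (A x) \<le> norm (z - A x) + norm z"
      using norm_triangle_ineq4[of "A x - z" "- z"] by (simp add: norm_minus_commute)
    then have "R * norm (A x) \<le> R * norm (z - A x) + R * norm z"
      using R by (metis distrib_left mult_left_mono)
    then show ?thesis
      using le[of x] by (simp add: h_def)
  qed
  have h_add: "h (x + x') (z + z') \<le> h x z + h x' z'" for x x' z z'
  proof -
    have "norm (z + z' - A (x + x')) \<le> norm (z - A x) + norm (z' - A x')"
      using norm_triangle_ineq[of "z - A x" "z' - A x'"] by (simp add: blinfun.add_right algebra_simps)
    then have "R * norm (z + z' - A (x + x')) \<le> R * norm (z - A x) + R * norm (z' - A x')"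
      using R by (metis distrib_left mult_left_mono)
    then show ?thesis
      by (simp add: h_def blinfun.add_right)
  qed
  have h_scale: "h (c *\<^sub>R x) (c *\<^sub>R z) \<le> c * h x z" if "c > 0" for c x z
    using that
    by (simp add: h_def blinfun.scaleR_right distrib_left flip: scaleR_diff_right)
  have sub: "sublinear (\<lambda>z. INF x\<in>UNIV. h x z)"
    and lower: "\<And>x z. (INF x\<in>UNIV. h x z) \<le> h x z"
    by (rule sublinear_INF[where B="\<lambda>z. - (R * norm z)"]; use h_add h_scale h_bound in auto)+
  obtain g where g: "linear g" "\<And>z. g z \<le> (INF x\<in>UNIV. h x z)"
    using sublinear_dominates_linear[OF sub] by metis
  have g_le: "g z \<le> h x z" for x z
    using g(2)[of z] lower[of z x] by linarith
  have "g z \<le> R * norm z" for z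
    using g_le[of z 0] by (simp add: h_def)
  then obtain w :: "'b \<Rightarrow>\<^sub>L real" where w: "\<And>z. blinfun_apply w z = g z"
    using linear_le_norm_imp_blinfun[OF g(1) _ R] by metis
  have "w (A x) \<le> \<xi> x" for x
    using g_le[of "A x" x] by (simp add: h_def w)
  from this[of "- _"] this have "w (A x) = \<xi> x" for x
    by (intro antisym) (simp_all add: blinfun.minus_right)
  then have "banach_adjoint A w = \<xi>"
    by (intro blinfun_eqI) (simp add: banach_adjoint_apply)
  then show ?thesis
    by blast
qed

text \<open>
  The distance to the range of \<open>A\<^sup>*\<close> is a seminorm on the dual space. A linear minorant of it that
  is exact at \<open>\<xi>\<close> annihilates the range, and reflexivity identifies it with a point in the kernel
  of \<open>A\<close>.
\<close>

lemma adjoint_dense_range: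
  fixes A :: "'a::real_normed_vector \<Rightarrow>\<^sub>L 'b::real_normed_vector"
  assumes refl: "reflexive_space TYPE('a)" and inj: "inj (blinfun_apply A)" and e: "0 < e"
  obtains w where "norm (\<xi> - banach_adjoint A w) < e"
proof -
  let ?A' = "banach_adjoint A"
  define h where "h w \<eta> = norm (\<eta> - ?A' w)" for w \<eta>
  have h_add: "h (v + w) (\<eta> + \<zeta>) \<le> h v \<eta> + h w \<zeta>" for v w \<eta> \<zeta>
    using norm_triangle_ineq[of "\<eta> - ?A' v" "\<zeta> - ?A' w"]
    by (simp add: h_def blinfun.add_right algebra_simps)
  have h_scale: "h (c *\<^sub>R w) (c *\<^sub>R \<eta>) \<le> c * h w \<eta>" if "c > 0" for c w \<eta>
    using that by (simp add: h_def blinfun.scaleR_right flip: scaleR_diff_right)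
  have sub: "sublinear (\<lambda>\<eta>. INF w\<in>UNIV. h w \<eta>)"
    and lower: "\<And>w \<eta>. (INF w\<in>UNIV. h w \<eta>) \<le> h w \<eta>"
    by (rule sublinear_INF[where B="\<lambda>\<eta>. 0"]; use h_add h_scale in \<open>auto simp: h_def\<close>)+
  obtain g where g: "linear g" "\<And>\<eta>. g \<eta> \<le> (INF w\<in>UNIV. h w \<eta>)" "g \<xi> = (INF w\<in>UNIV. h w \<xi>)"
    using sublinear_supporting_linear[OF sub] by metis
  have g_le: "g \<eta> \<le> h w \<eta>" for w \<eta>
    using g(2)[of \<eta>] lower[of \<eta> w] by linarith
  have "g \<eta> \<le> 1 * norm \<eta>" for \<eta>
    using g_le[of \<eta> 0] by (simp add: h_def)
  then obtain G :: "('a \<Rightarrow>\<^sub>L real) \<Rightarrow>\<^sub>L real" where G: "\<And>\<eta>. blinfun_apply G \<eta> = g \<eta>"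
    using linear_le_norm_imp_blinfun[OF g(1) _ zero_le_one] by metis
  obtain x where x: "\<And>\<eta>. blinfun_apply G \<eta> = blinfun_apply \<eta> x"
    using refl unfolding reflexive_space_def by metis
  have "w (A x) \<le> 0" for w :: "'b \<Rightarrow>\<^sub>L real"
  proof -
    have "w (A x) = g (?A' w)"
      using G[of "?A' w"] x[of "?A' w"] by (simp add: banach_adjoint_apply)
    also have "\<dots> \<le> h w (?A' w)"
      by (rule g_le)
    finally show ?thesis
      by (simp add: h_def)
  qed
  moreover obtain w :: "'b \<Rightarrow>\<^sub>L real" where "blinfun_apply w (A x) = norm (A x)"
    using norming_functional by metis
  ultimately have "A x = 0"
    by (metis norm_le_zero_iff)
  then have "x = 0"
    using injD[OF inj, of x 0] by simp
  then have "(INF w\<in>UNIV. h w \<xi>) < e"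
    using g(3) G[of \<xi>] x[of \<xi>] e by simp
  then have "\<exists>w\<in>UNIV. h w \<xi> < e"
    by (subst (asm) cINF_less_iff) (auto simp: h_def intro!: bdd_belowI[of _ 0])
  with that show thesis
    by (auto simp: h_def)
qed

section \<open>The distance function\<close>

lemma distance_function_le:
  "norm w \<le> R \<Longrightarrow> distance_function \<xi> A R \<le> norm (\<xi> - banach_adjoint A w)"
  unfolding distance_function_def by (intro cInf_lower) (auto intro!: bdd_belowI[of _ 0])

lemma distance_function_greatest:
  assumes "0 \<le> R" "\<And>w. norm w \<le> R \<Longrightarrow> m \<le> norm (\<xi> - banach_adjoint A w)"
  shows "m \<le> distance_function \<xi> A R"
  unfolding distance_function_def using assms
  by (intro cInf_greatest) (auto intro!: exI[of _ 0])

lemma distance_function_approx: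
  assumes "0 \<le> R" "distance_function \<xi> A R < m"
  obtains w where "norm w \<le> R" "norm (\<xi> - banach_adjoint A w) < m"
  using distance_function_greatest[of R m \<xi> A] assms by (meson not_le)

lemma distance_function_antimono:
  "0 \<le> R \<Longrightarrow> R \<le> S \<Longrightarrow> distance_function \<xi> A S \<le> distance_function \<xi> A R"
  by (rule distance_function_greatest) (auto intro: distance_function_le)

text \<open>
  The estimate behind the variational inequality: splitting \<open>\<xi>\<close> into \<open>A\<^sup>* w\<close> and a remainder and
  optimizing over the ball of radius \<open>R\<close>.
\<close>

lemma abs_le_distance_function:
  assumes "0 \<le> R"
  shows "\<bar>blinfun_apply \<xi> x\<bar> \<le> distance_function \<xi> A R * norm x + R * norm (A x)"
proof (cases "x = 0")
  case False
  have "(\<bar>\<xi> x\<bar> - R * norm (A x)) / norm x \<le> norm (\<xi> - banach_adjoint A w)" if w: "norm w \<le> R" for w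
  proof -
    have "\<xi> x = (\<xi> - banach_adjoint A w) x + w (A x)"
      by (simp add: banach_adjoint_apply blinfun.diff_left)
    then have "\<bar>\<xi> x\<bar> \<le> norm ((\<xi> - banach_adjoint A w) x) + norm (w (A x))"
      by simp
    also have "\<dots> \<le> norm (\<xi> - banach_adjoint A w) * norm x + norm w * norm (A x)"
      by (intro add_mono norm_blinfun)
    also have "\<dots> \<le> norm (\<xi> - banach_adjoint A w) * norm x + R * norm (A x)"
      using w by (simp add: mult_right_mono)
    finally show ?thesis
      using False by (simp add: field_simps)
  qed
  then have "(\<bar>\<xi> x\<bar> - R * norm (A x)) / norm x \<le> distance_function \<xi> A R"
    by (rule distance_function_greatest[OF assms])
  then show ?thesis
    using False by (simp add: field_simps)
qed simp

lemma distance_function_pos: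
  assumes "\<xi> \<notin> range (blinfun_apply (banach_adjoint A))" and R: "0 \<le> R"
  shows "0 < distance_function \<xi> A R"
proof (rule ccontr)
  assume "\<not> 0 < distance_function \<xi> A R"
  moreover have "0 \<le> distance_function \<xi> A R"
    by (rule distance_function_greatest[OF R]) simp
  ultimately have "distance_function \<xi> A R = 0"
    by simp
  then have "\<bar>blinfun_apply \<xi> x\<bar> \<le> R * norm (A x)" for x
    using abs_le_distance_function[OF R, of \<xi> x A] by simp
  with assms range_adjointI[OF _ R] show False
    by blast
qed

lemma distance_function_arbitrarily_small:
  fixes A :: "'a::real_normed_vector \<Rightarrow>\<^sub>L 'b::real_normed_vector"
  assumes "reflexive_space TYPE('a)" "inj (blinfun_apply A)" "0 < e"
  obtains R where "0 < R" "distance_function \<xi> A R < e"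
proof -
  obtain w where w: "norm (\<xi> - banach_adjoint A w) < e"
    using adjoint_dense_range[OF assms] by blast
  have "distance_function \<xi> A (norm w + 1) < e"
    using distance_function_le[of w "norm w + 1" \<xi> A] w by simp
  then show thesis
    by (intro that[of "norm w + 1"]) (auto simp: add_nonneg_pos)
qed

lemma convex_on_distance_function: "convex_on {0..} (distance_function \<xi> A)"
proof (rule convex_onI)
  fix t R S :: real
  assume t: "0 < t" "t < 1" and RS: "R \<in> {0..}" "S \<in> {0..}"
  let ?d = "distance_function \<xi> A" and ?A' = "banach_adjoint A"
  show "?d ((1 - t) *\<^sub>R R + t *\<^sub>R S) \<le> (1 - t) * ?d R + t * ?d S"
  proof (rule field_le_epsilon)
    fix e :: real assume e: "0 < e"
    obtain v where v: "norm v \<le> R" "norm (\<xi> - ?A' v) < ?d R + e"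
      using distance_function_approx[of R \<xi> A "?d R + e"] RS e by auto
    obtain w where w: "norm w \<le> S" "norm (\<xi> - ?A' w) < ?d S + e"
      using distance_function_approx[of S \<xi> A "?d S + e"] RS e by auto
    let ?u = "(1 - t) *\<^sub>R v + t *\<^sub>R w"
    have "norm ?u \<le> (1 - t) * norm v + t * norm w"
      using norm_triangle_ineq[of "(1 - t) *\<^sub>R v" "t *\<^sub>R w"] t by simp
    also have "\<dots> \<le> (1 - t) * R + t * S"
      using t v w by (intro add_mono mult_left_mono) auto
    finally have "?d ((1 - t) *\<^sub>R R + t *\<^sub>R S) \<le> norm (\<xi> - ?A' ?u)"
      by (intro distance_function_le) simp
    also have "\<xi> - ?A' ?u = (1 - t) *\<^sub>R (\<xi> - ?A' v) + t *\<^sub>R (\<xi> - ?A' w)"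
      by (simp add: blinfun.add_right blinfun.diff_right blinfun.scaleR_right algebra_simps)
    also have "norm \<dots> \<le> (1 - t) * norm (\<xi> - ?A' v) + t * norm (\<xi> - ?A' w)"
      using norm_triangle_ineq[of "(1 - t) *\<^sub>R (\<xi> - ?A' v)" "t *\<^sub>R (\<xi> - ?A' w)"] t by simp
    also have "\<dots> \<le> (1 - t) * (?d R + e) + t * (?d S + e)"
      using t v w by (intro add_mono mult_left_mono) auto
    also have "\<dots> = (1 - t) * ?d R + t * ?d S + e"
      by (simp add: algebra_simps)
    finally show "?d ((1 - t) *\<^sub>R R + t *\<^sub>R S) \<le> (1 - t) * ?d R + t * ?d S + e" .
  qed
qed simp

lemma continuous_on_distance_function: "continuous_on {0<..} (distance_function \<xi> A)"
  by (intro convex_on_continuous convex_on_subset[OF convex_on_distance_function]) auto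

text \<open>
  Since \<open>d\<close> tends to \<open>0\<close>, some \<open>T\<close> satisfies \<open>d T < d R\<close>. If \<open>S\<close> lies between \<open>R\<close> and \<open>T\<close>, then
  convexity puts \<open>d S\<close> below the chord, which is strictly below \<open>d R\<close>.
\<close>

lemma distance_function_strict_antimono:
  fixes A :: "'a::real_normed_vector \<Rightarrow>\<^sub>L 'b::real_normed_vector"
  assumes "reflexive_space TYPE('a)" "inj (blinfun_apply A)"
    and \<xi>: "\<xi> \<notin> range (blinfun_apply (banach_adjoint A))" and R: "0 \<le> R" "R < S"
  shows "distance_function \<xi> A S < distance_function \<xi> A R"
proof -
  let ?d = "distance_function \<xi> A"
  obtain T where T: "0 < T" "?d T < ?d R"
    using distance_function_arbitrarily_small[OF assms(1,2) distance_function_pos[OF \<xi> R(1)]] by metis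
  show ?thesis
  proof (cases "T \<le> S")
    case True
    then show ?thesis
      using distance_function_antimono[of T S \<xi> A] T by simp
  next
    case False
    define t where "t = (S - R) / (T - R)"
    have t: "0 < t" "t \<le> 1" and "t * (T - R) = S - R"
      using False R by (auto simp: t_def)
    then have S: "S = (1 - t) *\<^sub>R R + t *\<^sub>R T"
      by (simp add: algebra_simps)
    have "?d S \<le> (1 - t) * ?d R + t * ?d T"
      unfolding S using t R T by (intro convex_onD[OF convex_on_distance_function]) auto
    also have "\<dots> < (1 - t) * ?d R + t * ?d R"
      using t T by simp
    finally show ?thesis
      by (simp add: algebra_simps)
  qed
qed

section \<open>The balancing function and the rate\<close>

lemma balance_strict_antimono:
  fixes d :: "real \<Rightarrow> real"
  assumes pos: "\<And>R. 0 < R \<Longrightarrow> 0 < d R" and dec: "\<And>R S. 0 < R \<Longrightarrow> R < S \<Longrightarrow> d S < d R"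
    and p: "0 < p" and RS: "0 < R" "R < S"
  shows "d S powr p / S < d R powr p / R"
proof -
  have "d S powr p < d R powr p"
    using RS p pos[of S] dec[OF RS] by (intro powr_less_mono2) auto
  then show ?thesis
    using RS by (intro frac_less) auto
qed

text \<open>
  Surjectivity onto \<open>(0, \<infinity>)\<close> comes from comparing with \<open>d 1 powr p / R\<close>, which is a lower bound
  for \<open>R \<le> 1\<close> and an upper bound for \<open>R \<ge> 1\<close>.
\<close>

lemma bij_betw_balance:
  fixes d :: "real \<Rightarrow> real"
  assumes pos: "\<And>R. 0 < R \<Longrightarrow> 0 < d R" and dec: "\<And>R S. 0 < R \<Longrightarrow> R < S \<Longrightarrow> d S < d R"
    and cont: "continuous_on {0<..} d" and p: "0 < p"
  shows "bij_betw (\<lambda>R. d R powr p / R) {0<..} {0<..}"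
proof -
  let ?f = "\<lambda>R. d R powr p / R"
  have "inj_on ?f {0<..}"
  proof (rule linorder_inj_onI)
    fix R S :: real assume "R < S" "R \<in> {0<..}" "S \<in> {0<..}"
    then show "?f R \<noteq> ?f S"
      using balance_strict_antimono[of d p R S] pos dec p by force
  qed auto
  moreover have "?f R \<in> {0<..}" if "R \<in> {0<..}" for R
    using that pos[of R] by simp
  moreover have "s \<in> ?f ` {0<..}" if "s \<in> {0<..}" for s
  proof -
    have s: "0 < s" and d1: "0 < d 1 powr p"
      using that pos[of 1] by auto
    let ?a = "min 1 (d 1 powr p / s)" and ?b = "max 1 (d 1 powr p / s)"
    have a: "0 < ?a" "?a \<le> 1" and b: "1 \<le> ?b" and ab: "?a \<le> ?b"
      using s d1 by auto
    have mono: "d S powr p \<le> d R powr p" if "0 < R" "R \<le> S" for R S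
      using that p dec[of R S] pos[of S] by (cases "R = S") (auto intro!: powr_mono2)
    have "s * ?a \<le> d 1 powr p" and "d 1 powr p \<le> s * ?b"
      using s by (auto simp: min_def max_def field_simps)
    then have "s * ?a \<le> d ?a powr p" "d ?b powr p \<le> s * ?b"
      using mono[OF a] mono[of 1 ?b] b by linarith+
    then have "s \<le> ?f ?a" "?f ?b \<le> s"
      using a(1) b by (simp_all add: pos_le_divide_eq pos_divide_le_eq)
    moreover have "continuous_on {?a..?b} ?f"
    proof -
      have "continuous_on {?a..?b} d"
        using a(1) by (intro continuous_on_subset[OF cont]) auto
      moreover have "0 < R" if "R \<in> {?a..?b}" for R
        using that a(1) by (meson atLeastAtMost_iff less_le_trans)
      ultimately show ?thesis
        using pos by (intro continuous_intros) (metis order_less_irrefl)+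
    qed
    ultimately obtain R where "?a \<le> R" "R \<le> ?b" "?f R = s"
      using IVT2'[of ?f ?b s ?a] ab by blast
    then show ?thesis
      using a(1) by force
  qed
  ultimately show ?thesis
    by (auto simp: bij_betw_def)
qed

text \<open>
  The inverse of the balancing function is decreasing with open image, hence continuous on
  \<open>(0, \<infinity>)\<close>. At \<open>0\<close> the rate is continuous because \<open>d\<close> becomes arbitrarily small: below the
  balancing value of \<open>R\<close>, the inverse exceeds \<open>R\<close>.
\<close>

lemma index_function_balanced_rate:
  fixes d :: "real \<Rightarrow> real"
  assumes pos: "\<And>R. 0 < R \<Longrightarrow> 0 < d R" and dec: "\<And>R S. 0 < R \<Longrightarrow> R < S \<Longrightarrow> d S < d R"
    and cont: "continuous_on {0<..} d" and small: "\<And>e. 0 < e \<Longrightarrow> \<exists>R>0. d R < e" and p: "0 < p"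
  defines "g \<equiv> inv_into {0<..} (\<lambda>R. d R powr p / R)"
  shows "index_function (\<lambda>s. if s = 0 then 0 else d (g s) powr p)"
proof -
  let ?f = "\<lambda>R. d R powr p / R" and ?\<Phi> = "\<lambda>s. if s = 0 then 0 else d (g s) powr p"
  have bij: "bij_betw ?f {0<..} {0<..}"
    using pos dec cont p by (rule bij_betw_balance)
  have fg: "?f (g s) = s" and g_pos: "0 < g s" if "0 < s" for s
    using that bij_betw_inv_into_right[OF bij, of s] bij_betw_apply[OF bij_betw_inv_into[OF bij], of s]
    by (simp_all add: g_def)
  have antimono: "?f S < ?f R" if "0 < R" "R < S" for R S
    using balance_strict_antimono[of d p R S] pos dec p that by blast
  have g_less: "R < g s" if "0 < R" "0 < s" "s < ?f R" for R s
    using antimono[of "g s" R] fg[of s] g_pos[of s] that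
    by (metis less_asym linorder_neqE_linordered_idom order_less_irrefl)
  have g_dec: "g t < g s" if "0 < s" "s < t" for s t
    using g_less[of "g t" s] that fg[of t] g_pos[of t] by simp
  have image_g: "g ` {0<..} = {0<..}"
    using bij_betw_inv_into[OF bij] by (simp add: bij_betw_def g_def)
  have "continuous_on {0<..} (\<lambda>s. - g s)"
  proof (rule continuous_onI_mono)
    have "(\<lambda>s. - g s) ` {0<..} = uminus ` {0<..}"
      by (metis image_g image_image)
    then show "open ((\<lambda>s. - g s) ` {0<..})"
      by simp
    show "- g s \<le> - g t" if "s \<in> {0<..}" "t \<in> {0<..}" "s \<le> t" for s t
      using g_dec[of s t] that by (cases "s = t") auto
  qed
  then have "continuous_on {0<..} g"
    using continuous_on_minus by fastforce
  then have "continuous_on {0<..} (\<lambda>s. d (g s))"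
    by (intro continuous_on_compose2[OF cont]) (auto intro: g_pos)
  then have cont_pos: "continuous_on {0<..} (\<lambda>s. d (g s) powr p)"
    by (intro continuous_intros) (use pos g_pos in force)+
  have "continuous (at s within {0..}) ?\<Phi>" if s: "s \<in> {0..}" for s
  proof (cases "s = 0")
    case True
    show ?thesis
      unfolding True continuous_within_eps_delta
    proof (intro allI impI)
      fix e :: real assume e: "0 < e"
      then obtain R where R: "0 < R" "d R < e powr (1 / p)"
        using small[of "e powr (1 / p)"] by auto
      have "dist (?\<Phi> s) (?\<Phi> 0) < e" if "s \<in> {0..}" "dist s 0 < ?f R" for s
      proof (cases "s = 0")
        case False
        then have s: "0 < s" "s < ?f R"
          using that by auto
        have "d (g s) < e powr (1 / p)"
          using dec[OF R(1) g_less[OF R(1) s]] R(2) by simp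
        then have "d (g s) powr p < (e powr (1 / p)) powr p"
          using p pos[OF g_pos[OF s(1)]] by (intro powr_less_mono2) auto
        also have "\<dots> = e"
          using e p by (simp add: powr_powr)
        finally show ?thesis
          using False by simp
      qed (use e in simp)
      moreover have "0 < ?f R"
        using R(1) pos[of R] by simp
      ultimately show "\<exists>\<delta>>0. \<forall>s\<in>{0..}. dist s 0 < \<delta> \<longrightarrow> dist (?\<Phi> s) (?\<Phi> 0) < e"
        by blast
    qed
  next
    case False
    have "continuous_on {0<..} ?\<Phi>"
      using cont_pos by (rule continuous_on_eq) auto
    then have "isCont ?\<Phi> s"
      using s False continuous_on_eq_continuous_at[of "{0<..}" ?\<Phi>] by auto
    then show ?thesis
      by (rule continuous_at_imp_continuous_at_within)
  qed
  then have "continuous_on {0..} ?\<Phi>"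
    by (simp add: continuous_on_eq_continuous_within)
  moreover have "strict_mono_on {0..} ?\<Phi>"
  proof (rule strict_mono_onI)
    fix s t :: real assume st: "s \<in> {0..}" "t \<in> {0..}" "s < t"
    show "?\<Phi> s < ?\<Phi> t"
    proof (cases "s = 0")
      case True
      then show ?thesis
        using st pos[OF g_pos[of t]] by simp
    next
      case False
      then have "d (g s) < d (g t)"
        using st by (intro dec g_dec g_pos) auto
      then show ?thesis
        using False st p pos[OF g_pos[of s]] by (auto intro!: powr_less_mono2)
    qed
  qed
  ultimately show ?thesis
    by (auto simp: index_function_def)
qed

lemma index_function_comp:
  assumes f: "index_function f" and g: "index_function g"
  shows "index_function (f \<circ> g)"
proof -
  have g_range: "g ` {0..} \<subseteq> {0..}"
    using g by (simp add: index_function_def)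
  have "continuous_on {0..} (f \<circ> g)"
    using f g by (intro continuous_on_compose continuous_on_subset[OF _ g_range])
      (auto simp: index_function_def)
  moreover have "strict_mono_on {0..} (f \<circ> g)"
    using f g g_range unfolding index_function_def strict_mono_on_def by (auto simp: image_subset_iff)
  ultimately show ?thesis
    using f g by (auto simp: index_function_def image_subset_iff)
qed

section \<open>The variational inequality\<close>

theorem theorem2:
  fixes F :: "'a::banach \<Rightarrow> 'b::banach" and DF :: "'a set"
    and \<Omega> :: "'a \<Rightarrow> real" and D\<Omega> D :: "'a set"
    and \<psi> :: "real \<Rightarrow> real" and y :: 'b and x0 :: 'a
    and \<xi> :: "'a \<Rightarrow>\<^sub>L real" and A :: "'a \<Rightarrow>\<^sub>L 'b"
    and \<alpha>max \<rho> C q p c\<^sub>q :: real and M :: "'a set"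
    and J :: "real set" and \<sigma> :: "real \<Rightarrow> real"
  assumes "reflexive_space TYPE('a)" and "reflexive_space TYPE('b)"
    and D: "D = DF \<inter> D\<Omega>"
    and \<Omega>_nonneg: "\<And>x. x \<in> D\<Omega> \<Longrightarrow> 0 \<le> \<Omega> x"
    and "y \<in> F ` DF"
    and A2: "weakly_weakly_seq_continuous_on DF F" "weakly_seq_closed DF"
    and A3: "convex D\<Omega>" "convex_on D\<Omega> \<Omega>" "weakly_seq_lsc_on D\<Omega> \<Omega>"
    and A4: "D \<noteq> {}"
    and A5: "\<And>\<alpha> c u. \<lbrakk>\<alpha> > 0; c \<ge> 0; \<And>k :: nat. u k \<in> level_set D \<psi> F y \<Omega> \<alpha> c\<rbrakk> \<Longrightarrow>
               \<exists>r x. strict_mono r \<and> weakly_converges (u \<circ> r) x"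
    and A6: "index_function \<psi>"
            "\<exists>a>0. \<exists>b>0. \<forall>u\<ge>0. \<forall>v\<ge>0. \<psi> (u + v) \<le> a * \<psi> u + b * \<psi> v"
    and B1: "minimizing_solution D F y \<Omega> x0"
    and B2: "has_gateaux_derivative_on F A DF x0"
    and B3: "has_gateaux_derivative_on \<Omega> \<xi> D\<Omega> x0"
    and "inj (blinfun_apply A)"
    and "\<xi> \<notin> range (blinfun_apply (banach_adjoint A))"
    and "\<alpha>max > 0" and \<rho>: "\<rho> = \<alpha>max * (1 + \<Omega> x0)"
    and M: "M = level_set D \<psi> F y \<Omega> \<alpha>max \<rho>"
    and \<sigma>: "index_function_on J \<sigma>" "\<And>x. x \<in> M \<Longrightarrow> norm (F x - F x0) \<in> J"
    and "C > 0"
    and "\<And>x. x \<in> M \<Longrightarrow> norm (A (x - x0)) \<le> C * \<sigma> (norm (F x - F x0))"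
    and "2 \<le> q" and "c\<^sub>q > 0"
    and "\<And>x. x \<in> M \<Longrightarrow> bregman_distance \<Omega> \<xi> x x0 \<ge> c\<^sub>q * norm (x - x0) powr q"
    and p: "1 / q + 1 / p = 1"
  shows "bij_betw (Psi \<xi> A p) {0<..} {0<..} \<and>
         index_function_on J (rate_function \<xi> A p \<sigma>) \<and>
         (\<exists>\<beta>\<^sub>1 \<beta>\<^sub>2. 0 \<le> \<beta>\<^sub>1 \<and> \<beta>\<^sub>1 < 1 \<and> 0 < \<beta>\<^sub>2 \<and>
            (\<forall>x\<in>M. \<xi> (x0 - x) \<le> \<beta>\<^sub>1 * bregman_distance \<Omega> \<xi> x x0
                     + \<beta>\<^sub>2 * rate_function \<xi> A p \<sigma> (norm (F x - F x0))))"
proof (intro conjI)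
  let ?d = "distance_function \<xi> A"
  have p1: "1 < p"
  proof -
    have "1 / q \<le> 1 / 2"
      using \<open>2 \<le> q\<close> by (simp add: field_simps)
    moreover have "0 < 1 / q"
      using \<open>2 \<le> q\<close> by simp
    ultimately have "0 < 1 / p" "1 / p < 1"
      using p by linarith+
    then show ?thesis
      by (simp add: field_simps zero_less_divide_iff)
  qed
  have pos: "0 < ?d R" if "0 < R" for R
    using that \<open>\<xi> \<notin> _\<close> by (intro distance_function_pos) auto
  have dec: "?d S < ?d R" if "0 < R" "R < S" for R S
    using that by (intro distance_function_strict_antimono[OF \<open>reflexive_space TYPE('a)\<close> \<open>inj _\<close> \<open>\<xi> \<notin> _\<close>]) auto
  have small: "\<exists>R>0. ?d R < e" if "0 < e" for e
    using distance_function_arbitrarily_small[OF \<open>reflexive_space TYPE('a)\<close> \<open>inj _\<close> that] by metis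
  have Psi_eq: "Psi \<xi> A p = (\<lambda>R. ?d R powr p / R)"
    by (simp add: fun_eq_iff Psi_def)
  show bij: "bij_betw (Psi \<xi> A p) {0<..} {0<..}"
    unfolding Psi_eq using pos dec continuous_on_distance_function p1 by (intro bij_betw_balance) auto

  obtain \<theta> where J: "index_domain J" and \<theta>: "index_function \<theta>" "\<And>t. t \<in> J \<Longrightarrow> \<sigma> t = \<theta> t"
    using \<sigma>(1) by (auto simp: index_function_on_def)
  have J_nonneg: "0 \<le> t" if "t \<in> J" for t
    using J that by (auto simp: index_domain_def)
  have \<sigma>_pos: "0 < \<sigma> t" if "t \<in> J" "t \<noteq> 0" for t
    using \<theta> that J_nonneg[of t] unfolding index_function_def strict_mono_on_def by force
  have \<sigma>_zero: "\<sigma> 0 = 0" if "0 \<in> J"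
    using \<theta> that by (simp add: index_function_def)

  let ?\<Phi> = "\<lambda>s. if s = 0 then 0 else ?d (inv_into {0<..} (Psi \<xi> A p) s) powr p"
  have "index_function ?\<Phi>"
    unfolding Psi_eq using pos dec continuous_on_distance_function small p1
    by (intro index_function_balanced_rate) auto
  then have "index_function (?\<Phi> \<circ> \<theta>)"
    using \<theta>(1) by (rule index_function_comp)
  moreover have "rate_function \<xi> A p \<sigma> t = (?\<Phi> \<circ> \<theta>) t" if "t \<in> J" for t
    using that \<sigma>_pos[of t] \<sigma>_zero \<theta>(2)[of t] by (auto simp: rate_function_def)
  ultimately show "index_function_on J (rate_function \<xi> A p \<sigma>)"
    using J unfolding index_function_on_def by blast

  (* With \<epsilon> powr q = c\<^sub>q, Young's inequality for (\<epsilon> * norm (x - x0)) * (d R / \<epsilon>) produces the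
     lower bound of the Bregman distance with the factor 1 / q, and 1 / q < 1. *)
  define \<epsilon> where "\<epsilon> = c\<^sub>q powr (1 / q)"
  have \<epsilon>: "0 < \<epsilon>" "\<epsilon> powr q = c\<^sub>q"
    using \<open>c\<^sub>q > 0\<close> \<open>2 \<le> q\<close> by (auto simp: \<epsilon>_def powr_powr)
  define \<beta> where "\<beta> = 1 / (p * \<epsilon> powr p) + C"
  have "0 < \<beta>"
    using \<epsilon> p1 \<open>C > 0\<close> by (simp add: \<beta>_def add_pos_pos)
  moreover have "\<xi> (x0 - x) \<le> 1 / q * bregman_distance \<Omega> \<xi> x x0
      + \<beta> * rate_function \<xi> A p \<sigma> (norm (F x - F x0))" if x: "x \<in> M" for x
  proof -
    let ?t = "norm (F x - F x0)" and ?N = "norm (x - x0)" and ?D = "bregman_distance \<Omega> \<xi> x x0"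
    have nonlin: "norm (A (x - x0)) \<le> C * \<sigma> ?t" and coercive: "c\<^sub>q * ?N powr q \<le> ?D" and t: "?t \<in> J"
      using assms x by blast+
    show ?thesis
    proof (cases "?t = 0")
      case True
      then have "A (x - x0) = A 0"
        using nonlin t \<sigma>_zero by simp
      then have "x = x0"
        using injD[OF \<open>inj (blinfun_apply A)\<close>] by fastforce
      then show ?thesis
        by (simp add: bregman_distance_def rate_function_def)
    next
      case False
      define R where "R = inv_into {0<..} (Psi \<xi> A p) (\<sigma> ?t)"
      have "\<sigma> ?t \<in> {0<..}"
        using \<sigma>_pos[OF t False] by simp
      then have R: "0 < R" "Psi \<xi> A p R = \<sigma> ?t"
        using bij_betw_inv_into_right[OF bij] bij_betw_apply[OF bij_betw_inv_into[OF bij]]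
        by (auto simp: R_def)
      have rate: "rate_function \<xi> A p \<sigma> ?t = ?d R powr p"
        using False by (simp add: rate_function_def R_def)
      have balance: "R * \<sigma> ?t = ?d R powr p"
        using R by (auto simp: Psi_def field_simps)
      have "\<xi> (x0 - x) \<le> ?d R * ?N + R * norm (A (x - x0))"
        using abs_le_distance_function[of R \<xi> "x - x0" A] R(1)
        by (simp add: blinfun.diff_right abs_le_iff)
      also have "R * norm (A (x - x0)) \<le> R * (C * \<sigma> ?t)"
        using R(1) nonlin by (intro mult_left_mono) auto
      also have "\<dots> = C * ?d R powr p"
        using balance by (simp add: algebra_simps)
      also have "?d R * ?N = (\<epsilon> * ?N) * (?d R / \<epsilon>)"
        using \<epsilon> by simp
      also have "\<dots> \<le> (\<epsilon> * ?N) powr q / q + (?d R / \<epsilon>) powr p / p"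
        using \<open>2 \<le> q\<close> p1 p \<epsilon> pos[OF R(1)] by (intro Youngs_inequality) auto
      also have "(\<epsilon> * ?N) powr q / q = 1 / q * (c\<^sub>q * ?N powr q)"
        using \<epsilon> by (simp add: powr_mult)
      also have "\<dots> \<le> 1 / q * ?D"
        using coercive \<open>2 \<le> q\<close> by (intro mult_left_mono) auto
      also have "(?d R / \<epsilon>) powr p / p = 1 / (p * \<epsilon> powr p) * ?d R powr p"
        using \<epsilon> pos[OF R(1)] by (simp add: powr_divide)
      finally show ?thesis
        unfolding rate by (simp add: \<beta>_def algebra_simps)
    qed
  qed
  ultimately show "\<exists>\<beta>\<^sub>1 \<beta>\<^sub>2. 0 \<le> \<beta>\<^sub>1 \<and> \<beta>\<^sub>1 < 1 \<and> 0 < \<beta>\<^sub>2 \<and>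
            (\<forall>x\<in>M. \<xi> (x0 - x) \<le> \<beta>\<^sub>1 * bregman_distance \<Omega> \<xi> x x0
                     + \<beta>\<^sub>2 * rate_function \<xi> A p \<sigma> (norm (F x - F x0)))"
    using \<open>2 \<le> q\<close> by (intro exI[of _ "1 / q"] exI[of _ \<beta>]) auto
qed

end
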